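(* Let $V_*=\{V_i\}_{i\in I}$ be a monotone (standard), finite persistence module of vector spaces, with its index set identified with a subset $I\subset\mathbb{N}$, and let $\mathbb{R}$ be stratified ambiently by its subset $\mathbb{N}$. Let $F_V$ be the propagated persistence cosheaf of $V_*$ and let $\chi_V\colon\mathbb{R}\to\mathbb{Z}$ be its Euler curve. Then $$[F_V]=[\chi_V]\in K_0\big(\mathsf{pMod}^{\mathsf{Vect}}(\mathbb{R})\big).$$
   Context: $\mathsf{Vect}$ is the category of finite-dimensional vector spaces over a field $\mathbb{F}$; $\mathbb{N}=\{1,2,\dots\}$. A monotone persistence module is a functor $V\colon I\to\mathsf{Vect}$ from a linearly ordered set $I$ (here finite and nonempty), embedded order-preservingly in $\mathbb{N}$. $\mathbb{R}$ stratified by $\mathbb{N}$ has as strata the points of $\mathbb{N}$ and the components of $\mathbb{R}\setminus\mathbb{N}$; $\mathsf{Ent}_\Delta(\mathbb{R},\mathbb{N})$ is the category with strata as objects and a unique morphism $\sigma\to\tau$ whenever $\tau\subseteq\overline\sigma$. $\mathsf{pMod}^{\mathsf{Vect}}(\mathbb{R}):=\mathsf{Fun}(\mathsf{Ent}_\Delta(\mathbb{R},\mathbb{N}),\mathsf{Vect})$, equivalently constructible cosheaves, the value at a stratum being the costalk at its points. It is a Waldhausen category with componentwise isomorphisms as weak equivalences and componentwise monomorphisms as cofibrations; $K_0$ is $\pi_0$ of its Waldhausen K-theory spectrum (the abelian group generated by isomorphism classes modulo $[G]=[G']+[G'']$ for short exact sequences $0\to G'\to G\to G''\to0$). The propagated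 persistence cosheaf $F_V$ is constructible with respect to the points of $I$ (hence with respect to $\mathbb{N}$). Its costalk is $V_i$ at $i\in I$; $V_i$ on $(i,j)$ for consecutive $i<j$ in $I$; $V_{\min I}$ on $(-\infty,\min I)$; and $V_{\max I}$ on $(\max I,\infty)$. For consecutive $i<j$, the structure map from $(i,j)$ to $i$ is the identity and the structure map from $(i,j)$ to $j$ is $V_i\to V_j$; all remaining structure maps are identities. The (scaled) Euler curve is $\chi_V(x)=\operatorname{rank}(F_V)_x$, the rank of the costalk at $x\in\mathbb{R}$. A function $g\colon\mathbb{R}\to\mathbb{Z}$ constant on strata defines a class $[g]\in K_0(\mathsf{pMod}^{\mathsf{Vect}}(\mathbb{R}))$ as follows: write $g=g_+-g_-$ with $g_\pm\ge0$ constant on strata and set $[g]=[M_{g_+}]-[M_{g_-}]$, where for $h\ge 0$ the module $M_h$ has value $\mathbb{F}^{h(S)}$ at the stratum $S$ and all non-identity structure maps zero. *)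

theory Defs
  imports
    "HOL-Analysis.Analysis"
    "HOL-Algebra.Free_Abelian_Groups"
    "Jordan_Normal_Form.Missing_VectorSpace"
begin

section \<open>Functors from a preorder to finite-dimensional vector spaces\<close>

text \<open>A preorder category has the elements of a set \<open>P\<close> as objects and a unique morphism
  \<open>i \<rightarrow> j\<close> whenever \<open>R i j\<close>. Only the values of a diagram on \<open>P\<close>, on pairs with \<open>R i j\<close> and on
  the carriers of its vector spaces are meaningful.\<close>

record ('i, 'a, 'v) diagram =
  obj :: "'i \<Rightarrow> ('a, 'v) module"
  mor :: "'i \<Rightarrow> 'i \<Rightarrow> 'v \<Rightarrow> 'v"

locale vect_functor =
  fixes K :: "('a, 'm) ring_scheme"
    and P :: "'i set" and R :: "'i \<Rightarrow> 'i \<Rightarrow> bool"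
    and D :: "('i, 'a, 'v) diagram"
  assumes vectorspace_obj: "i \<in> P \<Longrightarrow> vectorspace K (obj D i)"
    and fin_dim_obj: "i \<in> P \<Longrightarrow> vectorspace.fin_dim K (obj D i)"
    and linear_mor: "\<lbrakk>i \<in> P; j \<in> P; R i j\<rbrakk> \<Longrightarrow> linear_map K (obj D i) (obj D j) (mor D i j)"
    and mor_id: "\<lbrakk>i \<in> P; v \<in> carrier (obj D i)\<rbrakk> \<Longrightarrow> mor D i i v = v"
    and mor_comp: "\<lbrakk>i \<in> P; j \<in> P; k \<in> P; R i j; R j k; v \<in> carrier (obj D i)\<rbrakk>
      \<Longrightarrow> mor D j k (mor D i j v) = mor D i k v"

definition nat_trans ::
  "('a, 'm) ring_scheme \<Rightarrow> 'i set \<Rightarrow> ('i \<Rightarrow> 'i \<Rightarrow> bool) \<Rightarrow>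
   ('i, 'a, 'v) diagram \<Rightarrow> ('i, 'a, 'w) diagram \<Rightarrow> ('i \<Rightarrow> 'v \<Rightarrow> 'w) \<Rightarrow> bool" where
  "nat_trans K P R D E \<phi> \<longleftrightarrow>
     (\<forall>i\<in>P. linear_map K (obj D i) (obj E i) (\<phi> i)) \<and>
     (\<forall>i\<in>P. \<forall>j\<in>P. R i j \<longrightarrow>
        (\<forall>v\<in>carrier (obj D i). \<phi> j (mor D i j v) = mor E i j (\<phi> i v)))"

definition nat_isomorphic ::
  "('a, 'm) ring_scheme \<Rightarrow> 'i set \<Rightarrow> ('i \<Rightarrow> 'i \<Rightarrow> bool) \<Rightarrow>
   ('i, 'a, 'v) diagram \<Rightarrow> ('i, 'a, 'w) diagram \<Rightarrow> bool" where
  "nat_isomorphic K P R D E \<longleftrightarrow>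
     (\<exists>\<phi>. nat_trans K P R D E \<phi> \<and>
          (\<forall>i\<in>P. bij_betw (\<phi> i) (carrier (obj D i)) (carrier (obj E i))))"

definition short_exact ::
  "('a, 'm) ring_scheme \<Rightarrow> 'i set \<Rightarrow> ('i \<Rightarrow> 'i \<Rightarrow> bool) \<Rightarrow>
   ('i, 'a, 'u) diagram \<Rightarrow> ('i, 'a, 'v) diagram \<Rightarrow> ('i, 'a, 'w) diagram \<Rightarrow> bool" where
  "short_exact K P R D' D D'' \<longleftrightarrow>
     (\<exists>\<phi> \<psi>. nat_trans K P R D' D \<phi> \<and> nat_trans K P R D D'' \<psi> \<and>
       (\<forall>i\<in>P. inj_on (\<phi> i) (carrier (obj D' i)) \<and>
          \<phi> i ` carrier (obj D' i) =
            {v \<in> carrier (obj D i). \<psi> i v = \<zero>\<^bsub>obj D'' i\<^esub>} \<and>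
          \<psi> i ` carrier (obj D i) = carrier (obj D'' i)))"


section \<open>The line stratified by the positive integers\<close>

definition nat_points :: "real set" where
  "nat_points = real ` {1..}"

definition strata :: "real set \<Rightarrow> real set set" where
  "strata P = (\<lambda>x. {x}) ` P \<union> components (- P)"

text \<open>The existence of the morphism \<open>\<sigma> \<rightarrow> \<tau>\<close> of the entrance path category.\<close>

definition ent :: "real set \<Rightarrow> real set \<Rightarrow> bool" where
  "ent \<sigma> \<tau> \<longleftrightarrow> \<tau> \<subseteq> closure \<sigma>"

abbreviation pMod :: "('a, 'm) ring_scheme \<Rightarrow> (real set, 'a, 'v) diagram \<Rightarrow> bool" where
  "pMod K \<equiv> vect_functor K (strata nat_points) ent"

definition stratum_at :: "real \<Rightarrow> real set" where
  "stratum_at x = (THE S. S \<in> strata nat_points \<and> x \<in> S)"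

definition costalk :: "(real set, 'a, 'v) diagram \<Rightarrow> real \<Rightarrow> ('a, 'v) module" where
  "costalk G x = obj G (stratum_at x)"


section \<open>The Grothendieck group\<close>

text \<open>Isomorphism classes are formed among the modules whose vector spaces have carriers in
  \<^typ>\<open>nat \<Rightarrow> 'a\<close>, where \<^typ>\<open>'a\<close> is the type of scalars. This type contains the coordinate spaces
  of all finite dimensions, so every module is isomorphic to one of these. Since isomorphisms may
  relate different carrier types, a module \<open>G\<close> with vector spaces over any carrier type \<^typ>\<open>'v\<close>
  has an isomorphism class.\<close>

definition iso_class ::
  "('a, 'm) ring_scheme \<Rightarrow> (real set, 'a, 'v) diagram \<Rightarrow> (real set, 'a, nat \<Rightarrow> 'a) diagram set" where
  "iso_class K G = {H. pMod K H \<and> nat_isomorphic K (strata nat_points) ent G H}"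

definition K0_free ::
  "('a, 'm) ring_scheme \<Rightarrow> ((real set, 'a, nat \<Rightarrow> 'a) diagram set \<Rightarrow>\<^sub>0 int) monoid" where
  "K0_free K = free_Abelian_group
     (iso_class K ` {G :: (real set, 'a, nat \<Rightarrow> 'a) diagram. pMod K G})"

definition K0_relations ::
  "('a, 'm) ring_scheme \<Rightarrow> ((real set, 'a, nat \<Rightarrow> 'a) diagram set \<Rightarrow>\<^sub>0 int) set" where
  "K0_relations K = generate (K0_free K)
     {frag_of (iso_class K G) - (frag_of (iso_class K G') + frag_of (iso_class K G'')) | G' G G''.
        pMod K (G' :: (real set, 'a, nat \<Rightarrow> 'a) diagram) \<and>
        pMod K (G :: (real set, 'a, nat \<Rightarrow> 'a) diagram) \<and>
        pMod K (G'' :: (real set, 'a, nat \<Rightarrow> 'a) diagram) \<and>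
        short_exact K (strata nat_points) ent G' G G''}"

definition K0 ::
  "('a, 'm) ring_scheme \<Rightarrow> ((real set, 'a, nat \<Rightarrow> 'a) diagram set \<Rightarrow>\<^sub>0 int) set monoid" where
  "K0 K = K0_free K Mod K0_relations K"

definition K0_class ::
  "('a, 'm) ring_scheme \<Rightarrow> (real set, 'a, 'v) diagram
    \<Rightarrow> ((real set, 'a, nat \<Rightarrow> 'a) diagram set \<Rightarrow>\<^sub>0 int) set" where
  "K0_class K G = K0_relations K #>\<^bsub>K0_free K\<^esub> frag_of (iso_class K G)"


section \<open>The class of an integer function that is constant on strata\<close>

definition zero_map_module ::
  "('a, 'm) ring_scheme \<Rightarrow> (real \<Rightarrow> nat) \<Rightarrow> (real set, 'a, nat \<Rightarrow> 'a) diagram" where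
  "zero_map_module K h =
     \<lparr>obj = (\<lambda>S. ring.func_space K {..<h (SOME x. x \<in> S)}),
      mor = (\<lambda>S T v. if S = T then v else \<zero>\<^bsub>ring.func_space K {..<h (SOME x. x \<in> T)}\<^esub>)\<rparr>"

text \<open>The conversion \<^const>\<open>nat\<close> truncates negative integers to zero, so the two modules below
  belong to the positive and the negative part of \<open>g\<close>.\<close>

definition function_class ::
  "('a, 'm) ring_scheme \<Rightarrow> (real \<Rightarrow> int)
    \<Rightarrow> ((real set, 'a, nat \<Rightarrow> 'a) diagram set \<Rightarrow>\<^sub>0 int) set" where
  "function_class K g =
     K0_class K (zero_map_module K (\<lambda>x. nat (g x)))
       \<otimes>\<^bsub>K0 K\<^esub> inv\<^bsub>K0 K\<^esub> K0_class K (zero_map_module K (\<lambda>x. nat (- g x)))"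


section \<open>The propagated persistence cosheaf and its Euler curve\<close>

definition propagated_index :: "nat set \<Rightarrow> real \<Rightarrow> nat" where
  "propagated_index I x =
     (if x < real (Min I) then Min I else Max {i \<in> I. real i \<le> x})"

text \<open>The index is constant on every stratum of the line. A morphism \<open>S \<rightarrow> T\<close> between distinct
  strata goes from an open interval to an endpoint; the index of \<open>T\<close> differs from that of \<open>S\<close> only
  if \<open>T = {j}\<close> is the right endpoint and \<open>j \<in> I\<close> is not the minimum, and then the structure map is
  \<open>V i \<rightarrow> V j\<close> for the predecessor \<open>i\<close> of \<open>j\<close> in \<open>I\<close>. All other structure maps are of the form
  \<open>V i \<rightarrow> V i\<close>, hence identities.\<close>

definition propagated_cosheaf ::
  "nat set \<Rightarrow> (nat, 'a, 'v) diagram \<Rightarrow> (real set, 'a, 'v) diagram" where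
  "propagated_cosheaf I V =
     (let idx = (\<lambda>S. propagated_index I (SOME x. x \<in> S)) in
      \<lparr>obj = (\<lambda>S. obj V (idx S)), mor = (\<lambda>S T. mor V (idx S) (idx T))\<rparr>)"

definition euler_curve ::
  "('a, 'm) ring_scheme \<Rightarrow> nat set \<Rightarrow> (nat, 'a, 'v) diagram \<Rightarrow> real \<Rightarrow> int" where
  "euler_curve K I V x = int (vectorspace.dim K (costalk (propagated_cosheaf I V) x))"

lemma nat_points_between:
  assumes "connected S" "S \<subseteq> - nat_points" "x \<in> S" "y \<in> closure S" "i \<in> {1..}" "real i \<le> y"
    and "real i \<noteq> y"
  shows "real i \<le> x"
proof (rule ccontr)
  assume "\<not> real i \<le> x"
  then have lt: "x < real i" "real i < y" using assms by auto
  have "open {real i<..}" by simp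
  moreover have "y \<in> {real i<..}" using lt by simp
  ultimately obtain z where z: "z \<in> S" "z \<in> {real i<..}"
    using assms(4) by (metis closure_iff_nhds_not_empty disjoint_iff order_refl)
  have "is_interval S" using assms(1) is_interval_connected_1 by blast
  then have "real i \<in> S"
    using assms(3) z lt unfolding is_interval_1 by (metis greaterThan_iff less_eq_real_def)
  with assms(2,5) show False unfolding nat_points_def by auto
qed

lemma propagated_index_alt:
  assumes "finite I" "I \<noteq> {}"
  shows "propagated_index I x =
    (if {i \<in> I. real i \<le> x} = {} then Min I else Max {i \<in> I. real i \<le> x})"
proof -
  have "x < real (Min I) \<longleftrightarrow> {i \<in> I. real i \<le> x} = {}"
  proof
    assume *: "x < real (Min I)"
    have "x < real i" if "i \<in> I" for i
      using * Min_le[OF assms(1) that] by linarith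
    then show "{i \<in> I. real i \<le> x} = {}" by (auto simp: not_le)
  next
    assume "{i \<in> I. real i \<le> x} = {}"
    then have "\<not> real (Min I) \<le> x" using Min_in[OF assms] by blast
    then show "x < real (Min I)" by simp
  qed
  then show ?thesis unfolding propagated_index_def by simp
qed

lemma propagated_index_in:
  assumes "finite I" "I \<noteq> {}"
  shows "propagated_index I x \<in> I"
proof (cases "{i \<in> I. real i \<le> x} = {}")
  case True
  then show ?thesis using propagated_index_alt[OF assms, of x] Min_in[OF assms] by simp
next
  case False
  have "Max {i \<in> I. real i \<le> x} \<in> {i \<in> I. real i \<le> x}"
    using False assms(1) by (intro Max_in) auto
  then show ?thesis
    unfolding propagated_index_alt[OF assms, of x] if_not_P[OF False] by blast
qed

lemma propagated_index_self:
  assumes "finite I" "i \<in> I"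
  shows "propagated_index I (real i) = i"
proof -
  have "Max {k \<in> I. real k \<le> real i} = i"
    using assms by (intro Max_eqI) auto
  moreover have "{k \<in> I. real k \<le> real i} \<noteq> {}" "I \<noteq> {}"
    using assms(2) by auto
  ultimately show ?thesis
    using propagated_index_alt[OF assms(1), of "real i"] by presburger
qed

lemma propagated_index_consecutive:
  assumes "finite I" "i \<in> I" "real i < x" "\<And>k. k \<in> I \<Longrightarrow> real k \<le> x \<Longrightarrow> k \<le> i"
  shows "propagated_index I x = i"
proof -
  have "Max {k \<in> I. real k \<le> x} = i"
    using assms by (intro Max_eqI) auto
  moreover have "i \<in> {k \<in> I. real k \<le> x}"
    using assms(2,3) by simp
  moreover have "I \<noteq> {}"
    using assms(2) by blast
  ultimately show ?thesis
    using propagated_index_alt[OF assms(1), of x] by (metis empty_iff)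
qed

lemma strata_cases:
  assumes "S \<in> strata nat_points"
  obtains n :: nat where "n \<ge> 1" "S = {real n}"
  | "S \<in> components (- nat_points)" "connected S" "S \<noteq> {}" "S \<subseteq> - nat_points"
  using assms unfolding strata_def nat_points_def
  by (auto dest: in_components_connected in_components_nonempty in_components_subset)

lemma strata_disjoint:
  assumes "S \<in> strata nat_points" "T \<in> strata nat_points" "x \<in> S" "x \<in> T"
  shows "S = T"
  using assms(1)
proof (cases rule: strata_cases)
  case (1 n)
  then have x: "x \<in> nat_points" using assms unfolding nat_points_def by auto
  from assms(2) show ?thesis using x 1 assms(3,4) by (cases rule: strata_cases) auto
next
  case 2
  then have "x \<notin> nat_points" using assms by auto
  moreover have "T \<in> components (- nat_points) \<or> T \<subseteq> nat_points"
    using assms(2) unfolding strata_def by auto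
  ultimately have "T \<in> components (- nat_points)" using assms(4) by auto
  then show ?thesis using 2(1) assms(3,4) components_nonoverlap by blast
qed

lemma stratum_at:
  shows "stratum_at x \<in> strata nat_points" and "x \<in> stratum_at x"
proof -
  have "\<exists>S. S \<in> strata nat_points \<and> x \<in> S"
  proof (cases "x \<in> nat_points")
    case True
    then show ?thesis unfolding strata_def by (intro exI[of _ "{x}"]) auto
  next
    case False
    then have "x \<in> \<Union>(components (- nat_points))"
      using Union_components[of "- nat_points"] by blast
    then show ?thesis unfolding strata_def by blast
  qed
  then have "\<exists>!S. S \<in> strata nat_points \<and> x \<in> S"
    using strata_disjoint by blast
  from theI'[OF this] show "stratum_at x \<in> strata nat_points" "x \<in> stratum_at x"
    unfolding stratum_at_def by auto
qed

lemma propagated_index_constant: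
  assumes "finite I" "I \<noteq> {}" "I \<subseteq> {1..}" "S \<in> strata nat_points" "x \<in> S" "y \<in> S"
  shows "propagated_index I x = propagated_index I y"
  using assms(4)
proof (cases rule: strata_cases)
  case (1 n)
  then show ?thesis using assms by simp
next
  case 2
  have "real i \<le> x" if "i \<in> I" "real i \<le> y" "x \<in> S" "y \<in> S" for i x y
  proof (rule nat_points_between[of S])
    show "y \<in> closure S" using that closure_subset by blast
    show "real i \<noteq> y" using that 2(4) assms(3) unfolding nat_points_def by fastforce
  qed (use that 2 assms(3) in auto)
  then have "{i \<in> I. real i \<le> x} = {i \<in> I. real i \<le> y}" using assms(5,6) by blast
  then show ?thesis by (simp only: propagated_index_alt[OF assms(1,2)])
qed

lemma propagated_index_SOME:
  assumes "finite I" "I \<noteq> {}" "I \<subseteq> {1..}" "S \<in> strata nat_points" "x \<in> S"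
  shows "propagated_index I (SOME x. x \<in> S) = propagated_index I x"
  using propagated_index_constant[OF assms(1-4)] assms(5) someI[of "\<lambda>x. x \<in> S"] by blast

lemma propagated_index_ent:
  assumes "finite I" "I \<noteq> {}" "I \<subseteq> {1..}" "S \<in> strata nat_points" "T \<in> strata nat_points"
    and "ent S T" "x \<in> S" "y \<in> T"
  shows "propagated_index I x \<le> propagated_index I y"
  using assms(4)
proof (cases rule: strata_cases)
  case (1 n)
  then have "x = y" using assms unfolding ent_def by auto
  then show ?thesis by simp
next
  case 2
  have y: "y \<in> closure S" using assms unfolding ent_def by auto
  define A where "A z = {i \<in> I. real i \<le> z}" for z
  have sub: "A x \<subseteq> A y"
  proof
    fix i assume i: "i \<in> A x"
    show "i \<in> A y"
    proof (rule ccontr)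
      assume "i \<notin> A y"
      then have lt: "y < real i" "real i \<le> x" using i unfolding A_def by auto
      obtain z where z: "z \<in> S" "z \<in> {..<real i}"
        using y lt by (metis closure_iff_nhds_not_empty disjoint_iff lessThan_iff open_lessThan order_refl)
      have "is_interval S" using 2 is_interval_connected_1 by blast
      then have "real i \<in> S"
        using assms(7) z lt unfolding is_interval_1 by (metis lessThan_iff less_eq_real_def)
      then show False using 2 i assms(3) unfolding nat_points_def A_def by auto
    qed
  qed
  have fin: "finite (A x)" "finite (A y)" using assms(1) unfolding A_def by auto
  show ?thesis
  proof (cases "A x = {}")
    case True
    then have "propagated_index I x = Min I"
      using propagated_index_alt[OF assms(1,2)] unfolding A_def by simp
    then show ?thesis using propagated_index_in[OF assms(1,2)] Min_le[OF assms(1)] by simp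
  next
    case False
    then have "A y \<noteq> {}" using sub by auto
    then have "Max (A x) \<le> Max (A y)" using False sub fin by (intro Max_mono) auto
    moreover have "propagated_index I x = Max (A x)" "propagated_index I y = Max (A y)"
      using False \<open>A y \<noteq> {}\<close> propagated_index_alt[OF assms(1,2)] unfolding A_def by presburger+
    ultimately show ?thesis by simp
  qed
qed

lemma costalk_propagated_cosheaf:
  assumes "finite I" "I \<noteq> {}" "I \<subseteq> {1..}"
  shows "costalk (propagated_cosheaf I V) x = obj V (propagated_index I x)"
  using propagated_index_SOME[OF assms stratum_at]
  unfolding costalk_def propagated_cosheaf_def by (simp add: Let_def)

lemma euler_curve_constant:
  assumes "S \<in> strata nat_points" "x \<in> S" "y \<in> S"
  shows "euler_curve K I V x = euler_curve K I V y"
proof -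
  have "stratum_at x = stratum_at y"
    using strata_disjoint[OF stratum_at(1) assms(1) stratum_at(2) assms(2)]
      strata_disjoint[OF stratum_at(1) assms(1) stratum_at(2) assms(3)] by simp
  then show ?thesis unfolding euler_curve_def costalk_def by simp
qed

lemma pMod_propagated_cosheaf:
  assumes "finite I" "I \<noteq> {}" "I \<subseteq> {1..}" "vect_functor K I (\<le>) V"
  shows "pMod K (propagated_cosheaf I V)"
proof -
  interpret V: vect_functor K I "(\<le>)" V by fact
  define idx where "idx S = propagated_index I (SOME x. x \<in> S)" for S
  have F: "obj (propagated_cosheaf I V) = (\<lambda>S. obj V (idx S))"
    "mor (propagated_cosheaf I V) = (\<lambda>S T. mor V (idx S) (idx T))"
    unfolding propagated_cosheaf_def idx_def by (simp_all add: Let_def)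
  have idx: "idx S \<in> I" for S
    unfolding idx_def using propagated_index_in assms by blast
  have ne: "(SOME x. x \<in> S) \<in> S" if "S \<in> strata nat_points" for S
    using that by (cases rule: strata_cases) (auto simp: some_in_eq)
  have mono: "idx S \<le> idx T"
    if "S \<in> strata nat_points" "T \<in> strata nat_points" "ent S T" for S T
    unfolding idx_def using propagated_index_ent[OF assms(1-3) that ne ne] that by blast
  show ?thesis
    by (rule vect_functor.intro)
      (simp_all add: F idx mono V.vectorspace_obj V.fin_dim_obj V.mor_id V.linear_mor V.mor_comp)
qed

end

theory Submission
  imports Defs
begin

text \<open>Choosing bases, replace \<open>F\<^sub>V\<close> by an isomorphic module \<open>G\<close> whose value at a stratum \<open>S\<close> is the
  coordinate space \<open>K\<^sup>n\<close> with \<open>n\<close> the value of the Euler curve on \<open>S\<close>. As non-identity morphisms only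
  go from intervals to points, the values of \<open>G\<close> at the points form a submodule, the quotient is
  supported on the intervals, and both have zero non-identity structure maps. Hence the submodule
  and the quotient do not depend on the structure maps of \<open>G\<close>, and the module with the same values
  but zero structure maps has the same class as \<open>G\<close>.\<close>

section \<open>Linear maps and coordinate spaces\<close>

lemma linear_mapI:
  assumes "vectorspace K V" "vectorspace K W"
    and "\<And>v. v \<in> carrier V \<Longrightarrow> f v \<in> carrier W"
    and "\<And>v w. v \<in> carrier V \<Longrightarrow> w \<in> carrier V \<Longrightarrow> f (v \<oplus>\<^bsub>V\<^esub> w) = f v \<oplus>\<^bsub>W\<^esub> f w"
    and "\<And>c v. c \<in> carrier K \<Longrightarrow> v \<in> carrier V \<Longrightarrow> f (c \<odot>\<^bsub>V\<^esub> v) = c \<odot>\<^bsub>W\<^esub> f v"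
  shows "linear_map K V W f"
  using assms
  by (auto intro!: linear_map.intro mod_hom.intro mod_hom_axioms.intro
      simp: vectorspace.axioms module_hom_def)

lemma linear_mapD:
  assumes "linear_map K V W f"
  shows "vectorspace K V" "vectorspace K W"
    and "\<And>v. v \<in> carrier V \<Longrightarrow> f v \<in> carrier W"
    and "\<And>v w. v \<in> carrier V \<Longrightarrow> w \<in> carrier V \<Longrightarrow> f (v \<oplus>\<^bsub>V\<^esub> w) = f v \<oplus>\<^bsub>W\<^esub> f w"
    and "\<And>c v. c \<in> carrier K \<Longrightarrow> v \<in> carrier V \<Longrightarrow> f (c \<odot>\<^bsub>V\<^esub> v) = c \<odot>\<^bsub>W\<^esub> f v"
    and "f \<zero>\<^bsub>V\<^esub> = \<zero>\<^bsub>W\<^esub>"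
proof -
  interpret linear_map K V W f by fact
  show "vectorspace K V" "vectorspace K W" by unfold_locales
  show "f v \<in> carrier W" if "v \<in> carrier V" for v using that by simp
  show "f (v \<oplus>\<^bsub>V\<^esub> w) = f v \<oplus>\<^bsub>W\<^esub> f w" if "v \<in> carrier V" "w \<in> carrier V" for v w
    using that by simp
  show "f (c \<odot>\<^bsub>V\<^esub> v) = c \<odot>\<^bsub>W\<^esub> f v" if "c \<in> carrier K" "v \<in> carrier V" for c v
    using that by simp
  show "f \<zero>\<^bsub>V\<^esub> = \<zero>\<^bsub>W\<^esub>" by simp
qed

lemma linear_map_id:
  assumes "vectorspace K V"
  shows "linear_map K V V (\<lambda>v. v)"
  using assms by (intro linear_mapI) auto

lemma linear_map_zero:
  assumes "vectorspace K V" "vectorspace K W"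
  shows "linear_map K V W (\<lambda>v. \<zero>\<^bsub>W\<^esub>)"
proof -
  interpret W: vectorspace K W by fact
  show ?thesis using assms by (intro linear_mapI) auto
qed

lemma linear_map_comp:
  assumes "linear_map K U V f" "linear_map K V W g"
  shows "linear_map K U W (\<lambda>u. g (f u))"
  using assms by (intro linear_mapI) (simp_all add: linear_mapD)

lemma linear_map_inv_into:
  assumes "linear_map K V W f" "bij_betw f (carrier V) (carrier W)"
  shows "linear_map K W V (inv_into (carrier V) f)"
proof -
  interpret linear_map K V W f by fact
  note f = assms(2)
  have in_V: "inv_into (carrier V) f w \<in> carrier V" if "w \<in> carrier W" for w
    using f that by (metis bij_betw_def inv_into_into)
  \<comment> \<open>Injectivity of \<open>f\<close> reduces each linearity law for the inverse to
    applying \<open>f\<close> to the proposed value.\<close>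
  have eqI: "inv_into (carrier V) f w = v" if "v \<in> carrier V" "f v = w" for v w
    using f that by (metis bij_betw_inv_into_left)
  show ?thesis
    by (intro linear_mapI eqI)
      (use in_V f in \<open>auto simp: bij_betw_inv_into_right linear_mapD(1,2)[OF assms(1)]\<close>)
qed

definition linear_iso where
  "linear_iso K V W f \<longleftrightarrow> linear_map K V W f \<and> bij_betw f (carrier V) (carrier W)"

lemma linear_isoD:
  assumes "linear_iso K V W f"
  shows "linear_map K V W f" "bij_betw f (carrier V) (carrier W)"
  using assms by (simp_all add: linear_iso_def)

lemma linear_iso_inv_into:
  "linear_iso K V W f \<Longrightarrow> linear_iso K W V (inv_into (carrier V) f)"
  unfolding linear_iso_def using linear_map_inv_into bij_betw_inv_into by blast

lemma linear_iso_comp: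
  "linear_iso K U V f \<Longrightarrow> linear_iso K V W g \<Longrightarrow> linear_iso K U W (\<lambda>u. g (f u))"
  unfolding linear_iso_def using linear_map_comp bij_betw_trans by (fastforce simp: comp_def)

lemma vectorspace_func_space:
  assumes "field K"
  shows "vectorspace K (ring.func_space K A)"
proof -
  interpret field K by fact
  show ?thesis using func_space_is_module assms by (simp add: vectorspace_def)
qed

text \<open>The indicator functions of the points of the finite set \<open>A\<close> span: a
  function is stripped of its entries one at a time.\<close>

lemma fin_dim_func_space:
  assumes "field K" "finite A"
  shows "vectorspace.fin_dim K (ring.func_space K A)"
proof -
  interpret field K by fact
  interpret V: vectorspace K "func_space A" by (rule vectorspace_func_space) fact
  \<comment> \<open>The standard basis vectors, restricted to \<open>A\<close> because members of
    the function space are extensional.\<close>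
  define e where "e i = (\<lambda>j\<in>A. if j = i then \<one>\<^bsub>K\<^esub> else \<zero>\<^bsub>K\<^esub>)" for i
  have e: "e ` A \<subseteq> carrier (func_space A)" by (auto simp: e_def func_space_def)
  interpret S: submodule K "V.span (e ` A)" "func_space A"
    using V.span_is_submodule e by blast
  \<comment> \<open>Induction on a set \<open>B\<close> outside which \<open>f\<close> vanishes; the
    case \<open>B = A\<close> is the spanning property.\<close>
  have "f \<in> V.span (e ` A)"
    if "B \<subseteq> A" "f \<in> carrier (func_space A)" "\<forall>i\<in>A - B. f i = \<zero>\<^bsub>K\<^esub>" for B f
    using finite_subset[OF that(1) assms(2)] that
  proof (induction B arbitrary: f rule: finite_induct)
    case empty
    then have "f = \<zero>\<^bsub>func_space A\<^esub>" by (auto simp: func_space_def fun_eq_iff PiE_iff extensional_def)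
    then show ?case by simp
  next
    case (insert i B)
    \<comment> \<open>\<open>g\<close> is \<open>f\<close> with its entry at \<open>i\<close>
      erased, so it vanishes outside the smaller set and \<open>f\<close> differs from it by a
      multiple of \<open>e i\<close>.\<close>
    define g where "g = (\<lambda>j\<in>A. if j = i then \<zero>\<^bsub>K\<^esub> else f j)"
    have fi: "f j \<in> carrier K" if "j \<in> A" for j using that insert by (auto simp: func_space_def)
    have "g \<in> V.span (e ` A)"
      by (rule insert.IH) (use insert fi in \<open>auto simp: g_def func_space_def\<close>)
    moreover have "f i \<odot>\<^bsub>func_space A\<^esub> e i \<in> V.span (e ` A)"
      using insert.prems e fi by (intro S.smult_closed) (auto intro: subsetD[OF V.in_own_span])
    moreover have "f = g \<oplus>\<^bsub>func_space A\<^esub> (f i \<odot>\<^bsub>func_space A\<^esub> e i)"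
    proof
      fix j
      show "f j = (g \<oplus>\<^bsub>func_space A\<^esub> (f i \<odot>\<^bsub>func_space A\<^esub> e i)) j"
        using insert.prems fi by (cases "j \<in> A") (auto simp: func_space_def g_def e_def)
    qed
    ultimately show ?case using S.m_closed by metis
  qed
  then have "V.span (e ` A) = carrier (func_space A)"
    using S.subset by blast
  then show ?thesis
    unfolding V.fin_dim_def using e assms(2) by blast
qed

text \<open>Pullback along \<open>g\<close> has pullback along \<open>inv_into A g\<close> as its
  inverse. The restrictions keep both results extensional.\<close>

lemma linear_iso_reindex:
  assumes "field K" "bij_betw g A B"
  shows "linear_iso K (ring.func_space K B) (ring.func_space K A) (\<lambda>f. \<lambda>i\<in>A. f (g i))"
proof -
  interpret field K by fact
  have g: "g i \<in> B" if "i \<in> A" for i using assms(2) that by (auto simp: bij_betw_def)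
  have "bij_betw (\<lambda>f. \<lambda>i\<in>A. f (g i)) (B \<rightarrow>\<^sub>E carrier K) (A \<rightarrow>\<^sub>E carrier K)"
  proof (rule bij_betw_byWitness[where f' = "\<lambda>f. \<lambda>j\<in>B. f (inv_into A g j)"])
    have inv: "inv_into A g j \<in> A" if "j \<in> B" for j
      using assms(2) that by (metis bij_betw_def inv_into_into)
    show "\<forall>f\<in>B \<rightarrow>\<^sub>E carrier K. (\<lambda>j\<in>B. (\<lambda>i\<in>A. f (g i)) (inv_into A g j)) = f"
      using assms(2) inv
      by (auto simp: fun_eq_iff bij_betw_inv_into_right PiE_iff extensional_def)
    show "\<forall>f\<in>A \<rightarrow>\<^sub>E carrier K. (\<lambda>i\<in>A. (\<lambda>j\<in>B. f (inv_into A g j)) (g i)) = f"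
      using assms(2) g
      by (auto simp: fun_eq_iff bij_betw_inv_into_left PiE_iff extensional_def)
  qed (use assms(2) g in \<open>auto simp: bij_betw_def inv_into_into\<close>)
  then show ?thesis
    unfolding linear_iso_def using g
    by (intro conjI linear_mapI vectorspace_func_space assms(1))
      (auto simp: func_space_def restrict_def fun_eq_iff)
qed

text \<open>Coordinates with respect to a finite basis: existence and uniqueness of the coefficients
  make \<open>lincomb\<close> a bijection, and an enumeration of the basis replaces it as index set
  by an initial segment of the naturals.\<close>

lemma linear_iso_func_space_exists:
  assumes "vectorspace K V" "vectorspace.fin_dim K V"
  shows "\<exists>f. linear_iso K V (ring.func_space K {..<vectorspace.dim K V}) f"
proof -
  interpret V: vectorspace K V by fact
  obtain B where B: "finite B" "V.basis B" using V.finite_basis_exists assms(2) by blast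
  then have sub: "B \<subseteq> carrier V" by (simp add: V.basis_def)
  let ?L = "\<lambda>a. V.lincomb a B"
  have "linear_map K (V.func_space B) V ?L"
    using B sub by (intro V.lincomb_is_linear) auto
  moreover have uniq: "\<exists>!a. a \<in> B \<rightarrow>\<^sub>E carrier K \<and> ?L a = v" if "v \<in> carrier V" for v
    using V.basis_criterion[OF B(1) sub] B(2) that by blast
  have closed: "?L a \<in> carrier V" if "a \<in> B \<rightarrow>\<^sub>E carrier K" for a
    using that sub B(1) by (intro V.lincomb_closed) auto
  have "bij_betw ?L (B \<rightarrow>\<^sub>E carrier K) (carrier V)"
  proof (intro bij_betw_imageI inj_onI)
    show "a = b" if "a \<in> B \<rightarrow>\<^sub>E carrier K" "b \<in> B \<rightarrow>\<^sub>E carrier K" "?L a = ?L b" for a b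
      using uniq[OF closed[OF that(2)]] that by blast
    show "?L ` (B \<rightarrow>\<^sub>E carrier K) = carrier V"
      using uniq closed by blast
  qed
  ultimately have "linear_iso K (V.func_space B) V ?L"
    unfolding linear_iso_def by (simp add: V.func_space_def)
  moreover obtain g where "bij_betw g {..<V.dim} B"
    using B ex_bij_betw_nat_finite[of B] V.dim_basis by (auto simp: atLeast0LessThan)
  moreover have "field K" by unfold_locales
  ultimately show ?thesis
    using linear_iso_comp linear_iso_inv_into linear_iso_reindex by blast
qed

section \<open>Isomorphism classes\<close>

lemma nat_isomorphic_iff:
  "nat_isomorphic K P R D E \<longleftrightarrow>
     (\<exists>\<phi>. (\<forall>i\<in>P. linear_iso K (obj D i) (obj E i) (\<phi> i)) \<and>
       (\<forall>i\<in>P. \<forall>j\<in>P. R i j \<longrightarrow>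
         (\<forall>v\<in>carrier (obj D i). \<phi> j (mor D i j v) = mor E i j (\<phi> i v))))"
  unfolding nat_isomorphic_def nat_trans_def linear_iso_def by blast

text \<open>The components are inverted one by one. Functoriality of \<open>D\<close> ensures that
  \<open>mor D i j\<close> lands in the carrier on which \<open>\<phi> j\<close> can be
  cancelled.\<close>

lemma nat_isomorphic_sym:
  assumes "vect_functor K P R D" "nat_isomorphic K P R D E"
  shows "nat_isomorphic K P R E D"
proof -
  interpret D: vect_functor K P R D by fact
  obtain \<phi> where iso: "\<And>i. i \<in> P \<Longrightarrow> linear_iso K (obj D i) (obj E i) (\<phi> i)"
    and nat: "\<And>i j v. \<lbrakk>i \<in> P; j \<in> P; R i j; v \<in> carrier (obj D i)\<rbrakk>
      \<Longrightarrow> \<phi> j (mor D i j v) = mor E i j (\<phi> i v)"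
    using assms(2) unfolding nat_isomorphic_iff by blast
  define \<psi> where "\<psi> i = inv_into (carrier (obj D i)) (\<phi> i)" for i
  have bij: "bij_betw (\<phi> i) (carrier (obj D i)) (carrier (obj E i))" if "i \<in> P" for i
    using iso[OF that] by (simp add: linear_iso_def)
  have "\<psi> j (mor E i j w) = mor D i j (\<psi> i w)"
    if ij: "i \<in> P" "j \<in> P" "R i j" and w: "w \<in> carrier (obj E i)" for i j w
  proof -
    have v: "\<psi> i w \<in> carrier (obj D i)" "\<phi> i (\<psi> i w) = w"
      using bij[OF ij(1)] w unfolding \<psi>_def
      by (auto simp: bij_betw_inv_into_right) (metis bij_betw_def inv_into_into)
    then have "mor D i j (\<psi> i w) \<in> carrier (obj D j)"
      using D.linear_mor[OF ij] by (simp add: linear_mapD)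
    moreover have "mor E i j w = \<phi> j (mor D i j (\<psi> i w))"
      using nat[OF ij v(1)] v(2) by simp
    ultimately show ?thesis
      using bij[OF ij(2)] unfolding \<psi>_def by (simp add: bij_betw_inv_into_left)
  qed
  moreover have "linear_iso K (obj E i) (obj D i) (\<psi> i)" if "i \<in> P" for i
    using linear_iso_inv_into[OF iso[OF that]] unfolding \<psi>_def .
  ultimately show ?thesis unfolding nat_isomorphic_iff by blast
qed

lemma nat_isomorphic_trans:
  assumes "nat_isomorphic K P R D E" "nat_isomorphic K P R E F"
  shows "nat_isomorphic K P R D F"
proof -
  obtain \<phi> where \<phi>: "\<And>i. i \<in> P \<Longrightarrow> linear_iso K (obj D i) (obj E i) (\<phi> i)"
      "\<And>i j v. \<lbrakk>i \<in> P; j \<in> P; R i j; v \<in> carrier (obj D i)\<rbrakk>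
        \<Longrightarrow> \<phi> j (mor D i j v) = mor E i j (\<phi> i v)"
    using assms(1) unfolding nat_isomorphic_iff by blast
  obtain \<psi> where \<psi>: "\<And>i. i \<in> P \<Longrightarrow> linear_iso K (obj E i) (obj F i) (\<psi> i)"
      "\<And>i j v. \<lbrakk>i \<in> P; j \<in> P; R i j; v \<in> carrier (obj E i)\<rbrakk>
        \<Longrightarrow> \<psi> j (mor E i j v) = mor F i j (\<psi> i v)"
    using assms(2) unfolding nat_isomorphic_iff by blast
  have "\<phi> i v \<in> carrier (obj E i)" if "i \<in> P" "v \<in> carrier (obj D i)" for i v
    using linear_isoD(1)[OF \<phi>(1)[OF that(1)]] that(2) by (simp add: linear_mapD)
  then show ?thesis
    unfolding nat_isomorphic_iff using linear_iso_comp[OF \<phi>(1) \<psi>(1)]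
    by (intro exI[of _ "\<lambda>i v. \<psi> i (\<phi> i v)"]) (simp add: \<phi>(2) \<psi>(2))
qed

text \<open>The carrier types of \<open>G\<close> and \<open>H\<close> may differ, so a module over
  any type can be exchanged for a coordinate module without changing its class.\<close>

lemma iso_class_eqI:
  assumes "pMod K G" "nat_isomorphic K (strata nat_points) ent G H"
  shows "iso_class K G = iso_class K H"
  unfolding iso_class_def
  using nat_isomorphic_trans[OF assms(2)] nat_isomorphic_trans[OF nat_isomorphic_sym[OF assms]]
  by (intro Collect_cong) blast

text \<open>Transport of structure along chosen coordinates. The new values are equal, not just
  isomorphic, to coordinate spaces, and they have carriers in \<open>nat \<Rightarrow> 'a\<close>,
  the type over which the generators of \<open>K0\<close> are formed.\<close>

lemma coordinate_functor_exists:
  assumes "vect_functor K P R D"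
  shows "\<exists>E. vect_functor K P R E \<and> nat_isomorphic K P R D E \<and>
    (\<forall>i\<in>P. obj E i = ring.func_space K {..<vectorspace.dim K (obj D i)})"
proof -
  interpret D: vect_functor K P R D by fact
  have "\<forall>i\<in>P. \<exists>f. linear_iso K (obj D i) (ring.func_space K {..<vectorspace.dim K (obj D i)}) f"
    using linear_iso_func_space_exists D.vectorspace_obj D.fin_dim_obj by blast
  then obtain \<beta> where \<beta>: "\<And>i. i \<in> P \<Longrightarrow>
      linear_iso K (obj D i) (ring.func_space K {..<vectorspace.dim K (obj D i)}) (\<beta> i)"
    by metis
  define \<gamma> where "\<gamma> i = inv_into (carrier (obj D i)) (\<beta> i)" for i
  \<comment> \<open>Each structure map is conjugated by the coordinates; in a composite the inner
    \<open>\<gamma> j\<close> and \<open>\<beta> j\<close> cancel.\<close>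
  define E where "E = \<lparr>obj = (\<lambda>i. ring.func_space K {..<vectorspace.dim K (obj D i)}),
    mor = (\<lambda>i j v. \<beta> j (mor D i j (\<gamma> i v)))\<rparr>"
  have \<beta>E: "linear_iso K (obj D i) (obj E i) (\<beta> i)" if "i \<in> P" for i
    using \<beta>[OF that] by (simp add: E_def)
  then have \<gamma>E: "linear_iso K (obj E i) (obj D i) (\<gamma> i)" if "i \<in> P" for i
    using linear_iso_inv_into that unfolding \<gamma>_def by blast
  have \<gamma>\<beta>: "\<gamma> i (\<beta> i v) = v" if "i \<in> P" "v \<in> carrier (obj D i)" for i v
    using linear_isoD(2)[OF \<beta>[OF that(1)]] that(2) unfolding \<gamma>_def by (simp add: bij_betw_inv_into_left)
  have \<beta>\<gamma>: "\<beta> i (\<gamma> i v) = v" if "i \<in> P" "v \<in> carrier (obj E i)" for i v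
    using linear_isoD(2)[OF \<beta>E[OF that(1)]] that(2) unfolding \<gamma>_def by (simp add: bij_betw_inv_into_right)
  have mor: "mor E i j v = \<beta> j (mor D i j (\<gamma> i v))" for i j v by (simp add: E_def)
  have \<gamma>_closed: "\<gamma> i v \<in> carrier (obj D i)" if "i \<in> P" "v \<in> carrier (obj E i)" for i v
    using linear_isoD(1)[OF \<gamma>E[OF that(1)]] that(2) by (simp add: linear_mapD)
  have D_closed: "mor D i j v \<in> carrier (obj D j)"
    if "i \<in> P" "j \<in> P" "R i j" "v \<in> carrier (obj D i)" for i j v
    using D.linear_mor[OF that(1-3)] that(4) by (simp add: linear_mapD)
  have "vect_functor K P R E"
  proof (rule vect_functor.intro)
    fix i assume i: "i \<in> P"
    interpret V: vectorspace K "obj D i" using i by (rule D.vectorspace_obj)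
    have "field K" by unfold_locales
    then show "vectorspace K (obj E i)" "vectorspace.fin_dim K (obj E i)"
      by (simp_all add: E_def vectorspace_func_space fin_dim_func_space)
    show "mor E i i v = v" if "v \<in> carrier (obj E i)" for v
      using that i by (simp add: mor D.mor_id \<gamma>_closed \<beta>\<gamma>)
    fix j assume j: "j \<in> P" "R i j"
    show "linear_map K (obj E i) (obj E j) (mor E i j)"
      unfolding mor using \<beta>E[OF j(1)] \<gamma>E[OF i] D.linear_mor[OF i j]
      by (auto simp: linear_iso_def intro: linear_map_comp)
    fix k v assume "k \<in> P" "R j k" "v \<in> carrier (obj E i)"
    then show "mor E j k (mor E i j v) = mor E i k v"
      using i j by (simp add: mor \<gamma>\<beta> D_closed \<gamma>_closed D.mor_comp)
  qed
  moreover have "nat_isomorphic K P R D E"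
    unfolding nat_isomorphic_iff using \<beta>E by (intro exI[of _ \<beta>]) (auto simp: mor \<gamma>\<beta>)
  ultimately show ?thesis by (intro exI[of _ E]) (simp add: E_def)
qed

section \<open>Modules on the stratified line\<close>

text \<open>A point is closed, so no other stratum lies in its closure. A component is relatively
  closed in the complement of \<open>nat_points\<close>, so its closure adds nothing but points of
  \<open>nat_points\<close>.\<close>

lemma ent_cases:
  assumes "S \<in> strata nat_points" "T \<in> strata nat_points" "ent S T"
  obtains "S = T" | "S \<inter> nat_points = {}" "T \<subseteq> nat_points" "S \<noteq> T"
proof (cases "S = T")
  case False
  have T: "T \<subseteq> closure S" using assms(3) by (simp add: ent_def)
  have "T \<noteq> {}" using assms(2) by (cases rule: strata_cases) auto
  show ?thesis
    using assms(1)
  proof (cases rule: strata_cases)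
    case (1 n)
    then show ?thesis using T \<open>T \<noteq> {}\<close> False by auto
  next
    case S: 2
    have "closedin (top_of_set (- nat_points)) S" using S(1) by (rule closedin_component)
    then obtain C where C: "closed C" "S = - nat_points \<inter> C"
      unfolding closedin_closed by blast
    then have "closure S \<subseteq> C" by (intro closure_minimal) auto
    then have closure: "closure S \<inter> - nat_points \<subseteq> S" using C(2) by blast
    show ?thesis
      using assms(2)
    proof (cases rule: strata_cases)
      case (1 m)
      then show ?thesis using S False that(2) by (auto simp: nat_points_def)
    next
      case 2
      then have "T \<subseteq> S" using T closure by blast
      then show ?thesis
        using strata_disjoint[OF assms(1,2)] \<open>T \<noteq> {}\<close> False by blast
    qed
  qed
qed

lemma some_in_stratum:
  assumes "S \<in> strata nat_points"
  shows "(SOME x. x \<in> S) \<in> S"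
  using assms by (cases rule: strata_cases) (auto simp: some_in_eq)

text \<open>Links the kind of a stratum to its chosen representative, at which
  \<open>zero_map_module\<close> evaluates its function.\<close>

lemma stratum_subset_iff:
  assumes "S \<in> strata nat_points"
  shows "S \<subseteq> nat_points \<longleftrightarrow> (SOME x. x \<in> S) \<in> nat_points"
  using assms
proof (cases rule: strata_cases)
  case (1 n)
  then show ?thesis by (auto simp: nat_points_def)
next
  case 2
  then show ?thesis using some_in_stratum[OF assms] by blast
qed

text \<open>Setting all non-identity maps to zero respects composition because two non-identity
  morphisms never compose.\<close>

lemma pMod_zero_map_module:
  fixes K :: "('a, 'm) ring_scheme"
  assumes "field K"
  shows "pMod K (zero_map_module K h)"
proof (rule vect_functor.intro)
  let ?M = "zero_map_module K h"
  note [simp] = zero_map_module_def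
  fix S assume S: "S \<in> strata nat_points"
  show vs: "vectorspace K (obj ?M S)" using assms by (simp add: vectorspace_func_space)
  show "vectorspace.fin_dim K (obj ?M S)" using assms by (simp add: fin_dim_func_space)
  show "mor ?M S S v = v" if "v \<in> carrier (obj ?M S)" for v by simp
  fix T assume T: "T \<in> strata nat_points" "ent S T"
  show "linear_map K (obj ?M S) (obj ?M T) (mor ?M S T)"
    using assms linear_map_id[OF vs]
    by (cases "S = T") (simp_all add: linear_map_zero vectorspace_func_space)
  fix U v assume U: "U \<in> strata nat_points" "ent T U"
  \<comment> \<open>Otherwise \<open>T\<close>, as a target, lies in \<open>nat_points\<close> and,
    as a source, is disjoint from it, although it is nonempty.\<close>
  have "S = T \<or> T = U"
    using some_in_stratum[OF T(1)] by (metis S T U ent_cases disjoint_iff subsetD)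
  then show "mor ?M T U (mor ?M S T v) = mor ?M S U v" by auto
qed

text \<open>The values at points form a submodule since no morphism leaves a point for another
  stratum. Neither outer term refers to the structure maps of \<open>G\<close>, only to
  \<open>h\<close>.\<close>

lemma short_exact_points_intervals:
  fixes K :: "('a, 'm) ring_scheme"
  assumes "field K" "pMod K G"
    and obj: "\<And>S. S \<in> strata nat_points \<Longrightarrow> obj G S = ring.func_space K {..<h (SOME x. x \<in> S)}"
  shows "short_exact K (strata nat_points) ent
    (zero_map_module K (\<lambda>x. if x \<in> nat_points then h x else 0)) G
    (zero_map_module K (\<lambda>x. if x \<in> nat_points then 0 else h x))"
    (is "short_exact K ?P ent ?A G ?B")
proof -
  interpret field K by fact
  interpret G: vect_functor K ?P ent G by fact
  interpret A: vect_functor K ?P ent ?A using assms(1) by (rule pMod_zero_map_module)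
  interpret B: vect_functor K ?P ent ?B using assms(1) by (rule pMod_zero_map_module)
  \<comment> \<open>At each stratum one outer term equals \<open>G\<close> and the other is zero, so
    identities and zero maps suffice.\<close>
  define \<phi> where "\<phi> S = (if S \<subseteq> nat_points then \<lambda>v. v else (\<lambda>v. \<zero>\<^bsub>obj G S\<^esub>))" for S
  define \<psi> where "\<psi> S = (if S \<subseteq> nat_points then \<lambda>v. \<zero>\<^bsub>obj ?B S\<^esub> else (\<lambda>v. v))" for S
  \<comment> \<open>Where the function is 0, the coordinate space over \<open>{..<0}\<close> has a
    single element, its zero.\<close>
  have point: "obj ?A S = obj G S" "carrier (obj ?B S) = {\<zero>\<^bsub>obj ?B S\<^esub>}"
    if "S \<in> ?P" "S \<subseteq> nat_points" for S
    using that stratum_subset_iff[OF that(1)] obj[OF that(1)]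
    by (auto simp: zero_map_module_def func_space_def)
  have interval: "obj ?B S = obj G S" "carrier (obj ?A S) = {\<zero>\<^bsub>obj ?A S\<^esub>}"
    if "S \<in> ?P" "\<not> S \<subseteq> nat_points" for S
    using that stratum_subset_iff[OF that(1)] obj[OF that(1)]
    by (auto simp: zero_map_module_def func_space_def)
  have zero_in: "\<zero>\<^bsub>obj G S\<^esub> \<in> carrier (obj G S)" if "S \<in> ?P" for S
    using obj[OF that] by (simp add: func_space_def)
  have lin_\<phi>: "linear_map K (obj ?A S) (obj G S) (\<phi> S)" if "S \<in> ?P" for S
    using point(1)[OF that] G.vectorspace_obj[OF that] A.vectorspace_obj[OF that]
    by (cases "S \<subseteq> nat_points") (simp_all add: \<phi>_def linear_map_id linear_map_zero)
  have lin_\<psi>: "linear_map K (obj G S) (obj ?B S) (\<psi> S)" if "S \<in> ?P" for S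
    using interval(1)[OF that] G.vectorspace_obj[OF that] B.vectorspace_obj[OF that]
    by (cases "S \<subseteq> nat_points") (simp_all add: \<psi>_def linear_map_id linear_map_zero)
  have "\<phi> T (mor ?A S T v) = mor G S T (\<phi> S v)"
    if ST: "S \<in> ?P" "T \<in> ?P" "ent S T" and v: "v \<in> carrier (obj ?A S)" for S T v
    using ST
  proof (cases rule: ent_cases)
    case 1
    then show ?thesis using ST v lin_\<phi>[OF ST(1)] by (simp add: A.mor_id G.mor_id linear_mapD)
  next
    \<comment> \<open>The source is an interval, where the submodule is zero: both sides are images
      of zero.\<close>
    case 2
    then have "\<not> S \<subseteq> nat_points" using some_in_stratum[OF ST(1)] by blast
    then have "v = \<zero>\<^bsub>obj ?A S\<^esub>" using interval(2)[OF ST(1)] v by blast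
    then show ?thesis
      using lin_\<phi>[OF ST(1)] lin_\<phi>[OF ST(2)] A.linear_mor[OF ST] G.linear_mor[OF ST]
      by (simp add: linear_mapD(6))
  qed
  then have nat_\<phi>: "nat_trans K ?P ent ?A G \<phi>"
    unfolding nat_trans_def using lin_\<phi> by blast
  have "\<psi> T (mor G S T v) = mor ?B S T (\<psi> S v)"
    if ST: "S \<in> ?P" "T \<in> ?P" "ent S T" and v: "v \<in> carrier (obj G S)" for S T v
    using ST
  proof (cases rule: ent_cases)
    case 1
    then show ?thesis using ST v lin_\<psi>[OF ST(1)] by (simp add: B.mor_id G.mor_id linear_mapD)
  next
    \<comment> \<open>The target is a point, where the quotient is zero: both sides lie in a
      one-element carrier.\<close>
    case 2
    have "\<psi> T (mor G S T v) \<in> carrier (obj ?B T)" "mor ?B S T (\<psi> S v) \<in> carrier (obj ?B T)"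
      using lin_\<psi>[OF ST(1)] lin_\<psi>[OF ST(2)] B.linear_mor[OF ST] G.linear_mor[OF ST] v
      by (simp_all add: linear_mapD(3))
    then show ?thesis using point(2)[OF ST(2)] 2 by auto
  qed
  then have nat_\<psi>: "nat_trans K ?P ent G ?B \<psi>"
    unfolding nat_trans_def using lin_\<psi> by blast
  have "inj_on (\<phi> S) (carrier (obj ?A S)) \<and>
      \<phi> S ` carrier (obj ?A S) = {v \<in> carrier (obj G S). \<psi> S v = \<zero>\<^bsub>obj ?B S\<^esub>} \<and>
      \<psi> S ` carrier (obj G S) = carrier (obj ?B S)" if S: "S \<in> ?P" for S
  proof (cases "S \<subseteq> nat_points")
    case True
    show ?thesis using True zero_in[OF S] point[OF S True] by (auto simp: \<phi>_def \<psi>_def)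
  next
    case False
    show ?thesis using False zero_in[OF S] interval[OF S False] by (auto simp: \<phi>_def \<psi>_def)
  qed
  then show ?thesis unfolding short_exact_def using nat_\<phi> nat_\<psi> by blast
qed

section \<open>The Grothendieck group\<close>

lemma iso_class_in_K0_free:
  fixes G :: "(real set, 'a, nat \<Rightarrow> 'a) diagram"
  assumes "pMod K G"
  shows "frag_of (iso_class K G) \<in> carrier (K0_free K)"
  using assms unfolding K0_free_def by auto

text \<open>Every subgroup of an abelian group is normal; what remains is that the relators lie in
  the free group.\<close>

lemma K0_relations_normal: "K0_relations K \<lhd> K0_free K"
proof -
  interpret comm_group "K0_free K"
    unfolding K0_free_def by (rule abelian_free_Abelian_group)
  have closed: "x - (y + z) \<in> carrier (K0_free K)"
    if "x \<in> carrier (K0_free K)" "y \<in> carrier (K0_free K)" "z \<in> carrier (K0_free K)" for x y z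
    using that keys_diff[of x "y + z"] keys_add[of y z]
    unfolding K0_free_def carrier_free_Abelian_group_iff by blast
  show ?thesis
    unfolding K0_relations_def
    by (intro subgroup_imp_normal generate_is_subgroup) (auto intro!: closed iso_class_in_K0_free)
qed

lemma group_K0: "group (K0 K)"
  unfolding K0_def by (rule normal.factorgroup_is_group[OF K0_relations_normal])

lemma K0_class_closed:
  fixes G :: "(real set, 'a, nat \<Rightarrow> 'a) diagram"
  assumes "pMod K G"
  shows "K0_class K G \<in> carrier (K0 K)"
  unfolding K0_class_def K0_def carrier_FactGroup using iso_class_in_K0_free[OF assms] by blast

text \<open>The relator of the sequence lies in the subgroup, so the generator of \<open>G\<close>
  and the sum of the other two generators have the same coset.\<close>

lemma K0_class_short_exact:
  fixes G' G G'' :: "(real set, 'a, nat \<Rightarrow> 'a) diagram"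
  assumes "pMod K G'" "pMod K G" "pMod K G''"
    and "short_exact K (strata nat_points) ent G' G G''"
  shows "K0_class K G = K0_class K G' \<otimes>\<^bsub>K0 K\<^esub> K0_class K G''"
proof -
  interpret N: normal "K0_relations K" "K0_free K" by (rule K0_relations_normal)
  let ?g = "\<lambda>G. frag_of (iso_class K G)"
  have closed: "?g G' \<in> carrier (K0_free K)" "?g G \<in> carrier (K0_free K)"
    "?g G'' \<in> carrier (K0_free K)"
    using assms(1-3) by (simp_all add: iso_class_in_K0_free)
  \<comment> \<open>The relators use addition of finitely supported functions, which is the group
    operation of the free abelian group.\<close>
  have plus: "x \<otimes>\<^bsub>K0_free K\<^esub> y = x + y" for x y by (simp add: K0_free_def)
  have sum: "?g G' + ?g G'' \<in> carrier (K0_free K)"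
    using N.m_closed[OF closed(1,3)] by (simp add: plus)
  have "?g G - (?g G' + ?g G'') \<in> K0_relations K"
    unfolding K0_relations_def using assms by (intro generate.incl) blast
  then have "?g G \<in> K0_relations K #>\<^bsub>K0_free K\<^esub> (?g G' + ?g G'')"
    unfolding r_coset_def plus by (auto intro!: bexI[of _ "?g G - (?g G' + ?g G'')"])
  then have "K0_relations K #>\<^bsub>K0_free K\<^esub> ?g G = K0_relations K #>\<^bsub>K0_free K\<^esub> (?g G' + ?g G'')"
    using N.repr_independence[OF _ sum N.subgroup_axioms] by simp
  then show ?thesis
    using N.rcos_sum[OF closed(1,3)] by (simp add: K0_class_def K0_def plus)
qed

text \<open>\<open>G\<close> and \<open>zero_map_module K h\<close> are extensions of the same
  quotient by the same submodule, so additivity gives both the same class.\<close>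

lemma K0_class_zero_map_module:
  fixes G :: "(real set, 'a, nat \<Rightarrow> 'a) diagram"
  assumes "field K" "pMod K G"
    and "\<And>S. S \<in> strata nat_points \<Longrightarrow> obj G S = ring.func_space K {..<h (SOME x. x \<in> S)}"
  shows "K0_class K G = K0_class K (zero_map_module K h)"
proof -
  have M: "obj (zero_map_module K h) S = ring.func_space K {..<h (SOME x. x \<in> S)}" for S
    by (simp add: zero_map_module_def)
  note pMod = pMod_zero_map_module[OF assms(1)]
  show ?thesis
    using K0_class_short_exact[OF pMod assms(2) pMod short_exact_points_intervals[OF assms]]
      K0_class_short_exact[OF pMod pMod pMod
        short_exact_points_intervals[OF assms(1) pMod[of h] M]] by simp
qed

text \<open>For \<open>h = 0\<close> the points and intervals sequence has the zero module in all
  three places, so its class is idempotent and hence neutral.\<close>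

lemma K0_class_zero_module:
  assumes "field K"
  shows "K0_class K (zero_map_module K (\<lambda>x. 0)) = \<one>\<^bsub>K0 K\<^esub>"
proof -
  interpret group "K0 K" by (rule group_K0)
  let ?Z = "zero_map_module K (\<lambda>x. 0)"
  note pMod = pMod_zero_map_module[OF assms, of "\<lambda>x. 0"]
  have "short_exact K (strata nat_points) ent ?Z ?Z ?Z"
    using short_exact_points_intervals[OF assms pMod, of "\<lambda>x. 0"]
    by (simp add: zero_map_module_def)
  then have "K0_class K ?Z = K0_class K ?Z \<otimes>\<^bsub>K0 K\<^esub> K0_class K ?Z"
    using K0_class_short_exact[OF pMod pMod pMod] by blast
  then show ?thesis using K0_class_closed[OF pMod] by simp
qed

text \<open>The negative part truncates to 0, so the inverted factor is neutral.\<close>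

lemma function_class_nonneg:
  assumes "field K" "\<And>x. g x \<ge> 0"
  shows "function_class K g = K0_class K (zero_map_module K (\<lambda>x. nat (g x)))"
proof -
  interpret group "K0 K" by (rule group_K0)
  show ?thesis
    using assms K0_class_closed[OF pMod_zero_map_module[OF assms(1)]]
    by (simp add: function_class_def K0_class_zero_module)
qed

theorem proposition5p2:
  fixes K :: "('a, 'm) ring_scheme"
    and I :: "nat set"
    and V :: "(nat, 'a, 'v) diagram"
  assumes "field K"
    and "finite I" and "I \<noteq> {}" and "I \<subseteq> {1..}"
    and "vect_functor K I (\<le>) V"
  shows "K0_class K (propagated_cosheaf I V) = function_class K (euler_curve K I V)"
proof -
  let ?F = "propagated_cosheaf I V"
  have F: "pMod K ?F" using assms(2-5) by (rule pMod_propagated_cosheaf)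
  obtain G where G: "pMod K G" "nat_isomorphic K (strata nat_points) ent ?F G"
    "\<And>S. S \<in> strata nat_points \<Longrightarrow>
      obj G S = ring.func_space K {..<vectorspace.dim K (obj ?F S)}"
    using coordinate_functor_exists[OF F] by blast
  \<comment> \<open>Both sides are the value of \<open>V\<close> at the propagated index of the
    representative of \<open>S\<close>; this turns the dimensions of \<open>G\<close> into values of
    the Euler curve.\<close>
  have "obj ?F S = costalk ?F (SOME x. x \<in> S)" for S
    unfolding costalk_propagated_cosheaf[OF assms(2-4)] by (simp add: propagated_cosheaf_def Let_def)
  then have obj: "obj G S = ring.func_space K {..<nat (euler_curve K I V (SOME x. x \<in> S))}"
    if "S \<in> strata nat_points" for S
    using G(3)[OF that] by (simp add: euler_curve_def)
  have "K0_class K ?F = K0_class K G"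
    using iso_class_eqI[OF F G(2)] by (simp add: K0_class_def)
  also have "\<dots> = K0_class K (zero_map_module K (\<lambda>x. nat (euler_curve K I V x)))"
    using assms(1) G(1) obj by (rule K0_class_zero_map_module)
  \<comment> \<open>The Euler curve consists of dimensions, so it has no negative part.\<close>
  also have "\<dots> = function_class K (euler_curve K I V)"
    using assms(1) by (simp add: function_class_nonneg euler_curve_def)
  finally show ?thesis .
qed

end
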